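(* There is no integer $d$ such that the class of (finite) graphs of layered treewidth at most $1$ has asymptotic dimension of linear type at most $d$.
   Context: All graphs are finite and simple, regarded as metric spaces $(V(G),d_G)$ with shortest-path distance. A tree-decomposition of $G$ is a pair $(T,(X_t)_{t\in V(T)})$ with $T$ a tree and bags $X_t\subseteq V(G)$ such that $\bigcup_t X_t=V(G)$, every edge has both ends in some bag, and for each vertex $v$ the set $\{t: v\in X_t\}$ induces a connected subtree. A layering of $G$ is an ordered partition $(V_i)_{i\in\mathbb N}$ or $(V_i)_{i\in\mathbb Z}$ of $V(G)$ into possibly empty layers such that every edge has both ends in $V_i\cup V_{i+1}$ for some $i$. The layered treewidth of $G$ is the minimum $w$ such that some tree-decomposition and some layering have every bag meeting every layer in at most $w$ vertices. For a metric space, a family $\mathcal U$ of subsets is $D$-bounded if each member has diameter at most $D$, and $r$-disjoint if points in different members are at distance $>r$. $D_X:\mathbb{R}^+\to\mathbb{R}^+$ is an $n$-dimensional control function if for every $r>0$ there is a cover $\mathcal U=\bigcup_{i=1}^{n+1}\mathcal U_i$ with each $\mathcal U_i$ $r$-disjoint and each member $D_X(r)$-bounded. A family of spaces has asymptotic dimension at most $n$ of linear type if there is a single $n$-dimensional control function $D$ for every member with $D(r)\le cr+c$ for some constant $c>0$ and all $r>0$. *)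

theory Defs
  imports "Graph_Theory.Graph_Theory" "HOL-Library.Disjoint_Sets"
begin

text \<open>
  A finite simple graph is a \<^locale>\<open>pair_graph\<close>: a finite vertex set together with a symmetric,
  irreflexive set of arcs, each undirected edge being represented by its two orientations.
\<close>

section \<open>Layered treewidth\<close>

text \<open>
  The predicate \<^const>\<open>Digraph_Component.tree\<close> of the library is not suitable here, because its
  notion of a cycle includes the closed walk of length 2 that traverses an edge and its reverse.
  In a simple undirected graph the cycles in the usual sense are those of length at least 3.
  \<^const>\<open>Digraph_Component.connected\<close> implies that the vertex set is nonempty.
\<close>

definition undirected_tree :: "'t pair_pre_digraph \<Rightarrow> bool" where
  "undirected_tree T \<longleftrightarrow>
     pair_graph T \<and> Digraph_Component.connected (with_proj T) \<and>
     \<not> (\<exists>p. pre_digraph.cycle (with_proj T) p \<and> 3 \<le> length p)"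

definition tree_decomposition ::
    "'a pair_pre_digraph \<Rightarrow> 't pair_pre_digraph \<Rightarrow> ('t \<Rightarrow> 'a set) \<Rightarrow> bool" where
  "tree_decomposition G T X \<longleftrightarrow>
     undirected_tree T \<and>
     (\<forall>t\<in>pverts T. X t \<subseteq> pverts G) \<and>
     (\<Union>t\<in>pverts T. X t) = pverts G \<and>
     (\<forall>(u, v)\<in>parcs G. \<exists>t\<in>pverts T. u \<in> X t \<and> v \<in> X t) \<and>
     (\<forall>v\<in>pverts G. Digraph_Component.connected (with_proj T \<restriction> {t \<in> pverts T. v \<in> X t}))"

text \<open>The index type is instantiated to \<^typ>\<open>nat\<close> and to \<^typ>\<open>int\<close> below.\<close>

definition layering :: "'a pair_pre_digraph \<Rightarrow> ('i::semiring_1 \<Rightarrow> 'a set) \<Rightarrow> bool" where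
  "layering G V \<longleftrightarrow>
     disjoint_family V \<and> (\<Union>i. V i) = pverts G \<and>
     (\<forall>(u, v)\<in>parcs G. \<exists>i. u \<in> V i \<union> V (i + 1) \<and> v \<in> V i \<union> V (i + 1))"

definition layered_width_le ::
    "'t pair_pre_digraph \<Rightarrow> ('t \<Rightarrow> 'a set) \<Rightarrow> ('i \<Rightarrow> 'a set) \<Rightarrow> nat \<Rightarrow> bool" where
  "layered_width_le T X V w \<longleftrightarrow> (\<forall>t\<in>pverts T. \<forall>i. card (X t \<inter> V i) \<le> w)"

text \<open>
  For finite graphs the minimum is attained over a nonempty set, since a single bag and a single
  nonempty layer are admissible. Trees are finite, so their nodes may be taken to be
  natural numbers.
\<close>

definition layered_treewidth :: "'a pair_pre_digraph \<Rightarrow> nat" where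
  "layered_treewidth G =
     (LEAST w. \<exists>(T :: nat pair_pre_digraph) X. tree_decomposition G T X \<and>
        ((\<exists>V :: nat \<Rightarrow> 'a set. layering G V \<and> layered_width_le T X V w) \<or>
         (\<exists>V :: int \<Rightarrow> 'a set. layering G V \<and> layered_width_le T X V w)))"


section \<open>Asymptotic dimension of linear type\<close>

text \<open>
  A metric space is a carrier set with a distance function. Distances are extended reals, so that
  vertices in different components of a graph have distance \<open>\<infinity>\<close>.
\<close>

type_synonym 'a mspace = "'a set \<times> ('a \<Rightarrow> 'a \<Rightarrow> ereal)"

definition diam :: "('a \<Rightarrow> 'a \<Rightarrow> ereal) \<Rightarrow> 'a set \<Rightarrow> ereal" where
  "diam d S = (SUP x\<in>S. SUP y\<in>S. d x y)"

definition bounded_family :: "('a \<Rightarrow> 'a \<Rightarrow> ereal) \<Rightarrow> real \<Rightarrow> 'a set set \<Rightarrow> bool" where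
  "bounded_family d D \<U> \<longleftrightarrow> (\<forall>S\<in>\<U>. diam d S \<le> ereal D)"

definition disjoint_by :: "('a \<Rightarrow> 'a \<Rightarrow> ereal) \<Rightarrow> real \<Rightarrow> 'a set set \<Rightarrow> bool" where
  "disjoint_by d r \<U> \<longleftrightarrow>
     (\<forall>A\<in>\<U>. \<forall>B\<in>\<U>. A \<noteq> B \<longrightarrow> (\<forall>x\<in>A. \<forall>y\<in>B. ereal r < d x y))"

text \<open>
  The dimension is an integer; for \<open>n < 0\<close> there are no families \<open>\<U> i\<close>, so that only the empty
  space has an \<open>n\<close>-dimensional control function.
\<close>

definition control_function :: "int \<Rightarrow> 'a mspace \<Rightarrow> (real \<Rightarrow> real) \<Rightarrow> bool" where
  "control_function n M D \<longleftrightarrow>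
     (case M of (X, d) \<Rightarrow>
       (\<forall>r>0. D r > 0) \<and>
       (\<forall>r>0. \<exists>\<U> :: int \<Rightarrow> 'a set set.
          (\<forall>i\<in>{1..n+1}. \<U> i \<subseteq> Pow X \<and> disjoint_by d r (\<U> i) \<and> bounded_family d (D r) (\<U> i)) \<and>
          \<Union> (\<Union>i\<in>{1..n+1}. \<U> i) = X))"

definition asdim_linear_le :: "'a mspace set \<Rightarrow> int \<Rightarrow> bool" where
  "asdim_linear_le \<X> n \<longleftrightarrow>
     (\<exists>D. (\<forall>M\<in>\<X>. control_function n M D) \<and> (\<exists>c>0. \<forall>r>0. D r \<le> c * r + c))"

definition graph_dist :: "'a pair_pre_digraph \<Rightarrow> 'a \<Rightarrow> 'a \<Rightarrow> ereal" where
  "graph_dist G = wf_digraph.\<mu> (with_proj G) (\<lambda>_. 1)"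

definition graph_mspace :: "'a pair_pre_digraph \<Rightarrow> 'a mspace" where
  "graph_mspace G = (pverts G, graph_dist G)"

end

(*
  Replacing every edge of a finite graph by a path of the same large even length M gives a graph of
  layered treewidth at most 1: the tree is a spider whose central bag contains all branch vertices,
  and each leg sweeps along one of the paths. Distances between branch vertices are multiplied by M,
  so a linear control function at scale M bounds the monochromatic components of a colouring of the
  original graph with d + 1 colours independently of that graph. This is violated by large cubical
  grids of dimension d + 1, in which for some i a component of colour i joins two opposite faces
  orthogonal to the i-th axis.
*)

theory Submission
  imports Defs "HOL-Analysis.Brouwer_Fixpoint"
begin

section \<open>Rooted trees\<close>

locale rooted_tree =
  fixes S :: "'t set" and root :: 't and par :: "'t \<Rightarrow> 't" and rank :: "'t \<Rightarrow> nat"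
  assumes finite_S: "finite S"
    and root_in: "root \<in> S"
    and par_in: "\<And>x. x \<in> S \<Longrightarrow> x \<noteq> root \<Longrightarrow> par x \<in> S"
    and rank_par: "\<And>x. x \<in> S \<Longrightarrow> x \<noteq> root \<Longrightarrow> rank (par x) < rank x"
begin

definition T :: "'t pair_pre_digraph" where
  "T = \<lparr>pverts = S,
        parcs = {(x, y). x \<in> S \<and> y \<in> S \<and> (x \<noteq> root \<and> y = par x \<or> y \<noteq> root \<and> x = par y)}\<rparr>"

lemma pverts_T [simp]: "pverts T = S"
  by (simp add: T_def)

lemma parcs_T: "(x, y) \<in> parcs T \<longleftrightarrow>
    x \<in> S \<and> y \<in> S \<and> (x \<noteq> root \<and> y = par x \<or> y \<noteq> root \<and> x = par y)"
  by (simp add: T_def)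

lemma pair_graph_T: "pair_graph T"
proof
  show "finite (parcs T)"
    by (rule finite_subset[of _ "S \<times> S"]) (auto simp: parcs_T finite_S)
  show "fst e \<noteq> snd e" if "e \<in> parcs T" for e
    using that rank_par by (cases e) (force simp: parcs_T)
  show "symmetric (with_proj T)"
    by (auto simp: symmetric_def sym_def parcs_T)
qed (auto simp: T_def finite_S)

text \<open>Following parents inside \<open>A\<close> can stop only at \<open>s\<close>, and it must
  stop because \<open>rank\<close> decreases. With \<open>A = S\<close> this connects the whole
  tree; with other \<open>A\<close> it handles the subtrees required of a decomposition.\<close>

lemma connected_induced:
  assumes "A \<subseteq> S" "s \<in> A"
    and up: "\<And>x. x \<in> A \<Longrightarrow> x \<noteq> s \<Longrightarrow> x \<noteq> root \<and> par x \<in> A"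
  shows "Digraph_Component.connected (with_proj T \<restriction> A)"
proof -
  define R where "R = arcs_ends (with_proj T \<restriction> A)"
  have R: "(x, y) \<in> R \<longleftrightarrow> x \<in> A \<and> y \<in> A \<and> (x, y) \<in> parcs T" for x y
    by (force simp: R_def arcs_ends_def arc_to_ends_def)
  have symR: "sym R"
    by (auto simp: sym_def R parcs_T)
  have to_s: "(x, s) \<in> rtrancl_on A R" if "x \<in> A" for x
    using that
  proof (induction "rank x" arbitrary: x rule: less_induct)
    case less
    show ?case
    proof (cases "x = s")
      case False
      then have x: "x \<noteq> root" "par x \<in> A" "x \<in> S"
        using up less.prems assms(1) by auto
      then have "(par x, s) \<in> rtrancl_on A R"
        using less.hyps rank_par by auto
      moreover have "(x, par x) \<in> R"
        using x less.prems assms(1) by (auto simp: R parcs_T par_in)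
      ultimately show ?thesis
        using less.prems by (meson converse_rtrancl_on_into_rtrancl_on)
    qed (use assms in auto)
  qed
  have from_s: "(s, x) \<in> rtrancl_on A R" if "x \<in> A" for x
    using rtrancl_on_sym[OF symR] to_s[OF that] by (meson symE)
  have "(x, y) \<in> rtrancl_on A R" if "x \<in> A" "y \<in> A" for x y
    using to_s from_s that by (meson rtrancl_on_trans)
  moreover have "R\<^sup>s = R"
    using symR by (auto simp: symcl_def sym_def)
  ultimately show ?thesis
    using assms(2) by (auto simp: connected_conv R_def[symmetric])
qed

text \<open>Both neighbours of a vertex of maximal rank on a cycle would be its parent.\<close>

lemma no_cycle:
  assumes "pre_digraph.cycle (with_proj T) p"
  shows "length p < 3"
proof (rule ccontr)
  assume "\<not> length p < 3"
  define L where "L = length p"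
  have L: "L \<ge> 3"
    using \<open>\<not> length p < 3\<close> by (simp add: L_def)
  interpret pair_graph T by (rule pair_graph_T)
  obtain u where u: "awalk u p u" "distinct (tl (pawalk_verts u p))" "p \<noteq> []"
    using assms by (auto simp: cycle_def)
  then have cas: "pcas u p u" and arcs: "set p \<subseteq> parcs T"
    by (auto simp: awalk_def)
  have "tl (pawalk_verts u p) = map snd p"
    using awalk_verts_conv'[OF cas] u(3) by simp
  with u have dist: "distinct (map snd p)" by simp
  \<comment> \<open>The heads of the arcs as an \<open>L\<close>-periodic sequence, so that the base
    point \<open>u\<close> needs no special treatment.\<close>
  define f where "f k = snd (p ! (k mod L))" for k
  have step: "fst (q ! Suc k) = snd (q ! k)" if "pcas v q w" "Suc k < length q" for v w q k
    using that
  proof (induction q arbitrary: v k)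
    case (Cons e es)
    then show ?case by (cases k; cases es) auto
  qed simp
  have wrap: "fst (q ! 0) = v \<and> snd (q ! (length q - 1)) = w"
    if "pcas v q w" "q \<noteq> []" for v w q
    using that
  proof (induction q arbitrary: v)
    case (Cons e es)
    then show ?case by (cases es) auto
  qed simp
  have arc: "(f k, f (Suc k)) \<in> parcs T" for k
  proof -
    have "Suc k mod L < L" using L by simp
    then have "p ! (Suc k mod L) \<in> parcs T"
      using arcs unfolding L_def by (meson nth_mem subsetD)
    moreover have "fst (p ! (Suc k mod L)) = f k"
    proof (cases "Suc (k mod L) = L")
      case True
      then have "Suc k mod L = 0" by (simp add: mod_Suc)
      moreover have "k mod L = length p - 1" using True by (simp add: L_def)
      ultimately show ?thesis using wrap[OF cas u(3)] by (simp add: f_def)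
    next
      case False
      then have "Suc k mod L = Suc (k mod L)" by (simp add: mod_Suc)
      moreover have "Suc (k mod L) < L"
        using False L by (metis Suc_lessI mod_less_divisor not_numeral_le_zero zero_less_iff_neq_zero)
      ultimately show ?thesis using step[OF cas] by (simp add: f_def L_def)
    qed
    ultimately show ?thesis by (metis f_def prod.collapse)
  qed
  define m where "m = Max ((\<lambda>k. rank (f k)) ` {..<L})"
  have "m \<in> (\<lambda>k. rank (f k)) ` {..<L}"
    unfolding m_def using L by (intro Max_in) (auto simp: lessThan_empty_iff)
  then obtain k where k: "k < L" "rank (f k) = m" by auto
  have max: "rank (f j) \<le> rank (f k)" for j
  proof -
    have "rank (f (j mod L)) \<le> m"
      unfolding m_def using L by (intro Max_ge) auto
    then show ?thesis using k by (simp add: f_def)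
  qed
  \<comment> \<open>The cyclic predecessor of \<open>k\<close>; adding \<open>L\<close> avoids
    truncated subtraction at \<open>k = 0\<close>.\<close>
  define j where "j = k + L - 1"
  have fj: "f (Suc j) = f k" using L by (simp add: j_def f_def)
  have "f j = par (f k)"
    using arc[of j] max[of j] rank_par[of "f j"] unfolding fj by (auto simp: parcs_T)
  moreover have "f (Suc (Suc j)) = par (f k)"
    using arc[of "Suc j"] max[of "Suc (Suc j)"] rank_par[of "f (Suc (Suc j))"]
    unfolding fj by (auto simp: parcs_T)
  ultimately have "f j = f (j + 2)" by simp
  then have "map snd p ! (j mod L) = map snd p ! ((j + 2) mod L)"
    using L u(3) by (simp add: f_def L_def nth_map)
  moreover have "j mod L < length (map snd p)" "(j + 2) mod L < length (map snd p)"
    using L u(3) by (simp_all add: L_def)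
  ultimately have "j mod L = (j + 2) mod L"
    using dist nth_eq_iff_index_eq by blast
  then have "L dvd 2"
    using mod_eq_dvd_iff_nat[of j "j + 2" L] by simp
  then show False
    using L dvd_imp_le[of L 2] by simp
qed

lemma undirected_tree_T: "undirected_tree T"
proof -
  have "Digraph_Component.connected (with_proj T \<restriction> S)"
    by (rule connected_induced[of _ root]) (auto simp: root_in par_in)
  moreover have "with_proj T \<restriction> S = with_proj T"
    by (auto simp: induce_subgraph_def with_proj_def T_def)
  ultimately show ?thesis
    unfolding undirected_tree_def using pair_graph_T no_cycle by fastforce
qed

end

section \<open>Distances in graphs\<close>

lemma (in wf_digraph) awalk_cost_one: "awalk_cost (\<lambda>_. 1) p = real (length p)"
  by (induction p) auto

lemma graph_dist_le_of_walk:
  assumes "pair_wf_digraph G" "q 0 \<in> pverts G"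
    and arcs: "\<And>t. t < n \<Longrightarrow> (q t, q (Suc t)) \<in> parcs G"
  shows "graph_dist G (q 0) (q n) \<le> ereal (real n)"
proof -
  interpret pair_wf_digraph G by fact
  have "\<exists>p. awalk (q 0) p (q n) \<and> length p = n"
    using arcs
  proof (induction n)
    case 0
    then show ?case using assms(2) by (auto simp: awalk_Nil_iff)
  next
    case (Suc n)
    then obtain p where "awalk (q 0) p (q n)" "length p = n" by auto
    moreover have "awalk (q n) [(q n, q (Suc n))] (q (Suc n))"
      using arc_implies_awalk[of "(q n, q (Suc n))"] Suc.prems[of n] by simp
    ultimately have "awalk (q 0) (p @ [(q n, q (Suc n))]) (q (Suc n))"
      "length (p @ [(q n, q (Suc n))]) = Suc n"
      by (auto intro: awalk_appendI)
    then show ?case by blast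
  qed
  then show ?thesis
    using min_cost_le_walk_cost[of "q 0" _ "q n" "\<lambda>_. 1"]
    by (auto simp: graph_dist_def awalk_cost_one)
qed

text \<open>Each arc of a walk changes \<open>f\<close> by at most 1, and the distance is an infimum
  over walks. If there is no walk, it is infinite.\<close>

lemma Lipschitz_le_graph_dist:
  fixes f :: "'a \<Rightarrow> real"
  assumes "pair_wf_digraph G"
    and f: "\<And>x y. (x, y) \<in> parcs G \<Longrightarrow> \<bar>f x - f y\<bar> \<le> 1"
  shows "ereal \<bar>f u - f v\<bar> \<le> graph_dist G u v"
proof -
  interpret pair_wf_digraph G by fact
  have "\<bar>f u - f v\<bar> \<le> real (length p)" if "awalk u p v" for p
    using that
  proof (induction p arbitrary: u)
    case Nil
    then show ?case by (simp add: awalk_Nil_iff)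
  next
    case (Cons e es)
    then have "\<bar>f u - f (snd e)\<bar> \<le> 1" "\<bar>f (snd e) - f v\<bar> \<le> real (length es)"
      using f[of "fst e" "snd e"] by (auto simp: awalk_Cons_iff)
    then show ?case by simp
  qed
  then show ?thesis
    unfolding graph_dist_def \<mu>_def by (intro INF_greatest) (simp add: awalk_cost_one)
qed

section \<open>A combinatorial covering theorem for cubes\<close>

text \<open>Coordinates from \<open>n\<close> on are left free, as in
  \<open>kuhn_lemma\<close>.\<close>

definition cube :: "nat \<Rightarrow> nat \<Rightarrow> (nat \<Rightarrow> nat) set" where
  "cube n p = {x. \<forall>i<n. x i \<le> p}"

definition near :: "nat \<Rightarrow> nat \<Rightarrow> (nat \<Rightarrow> nat) \<Rightarrow> (nat \<Rightarrow> nat) \<Rightarrow> bool" where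
  "near n k x y \<longleftrightarrow> (\<forall>i<n. x i \<le> y i + k \<and> y i \<le> x i + k)"

text \<open>The radius 2 is the sum of two radii 1: from a component to a labelled corner, and from
  that corner to the corner of the small cube.\<close>

definition col_step :: "nat \<Rightarrow> nat \<Rightarrow> ((nat \<Rightarrow> nat) \<Rightarrow> nat) \<Rightarrow> nat \<Rightarrow> (nat \<Rightarrow> nat) rel" where
  "col_step n p col i =
     {(x, y). x \<in> cube n p \<and> y \<in> cube n p \<and> col x = i \<and> col y = i \<and> near n 2 x y}"

lemma near_sym: "near n k x y \<longleftrightarrow> near n k y x"
  by (auto simp: near_def)

lemma near_trans: "near n k x y \<Longrightarrow> near n l y z \<Longrightarrow> near n (k + l) x z"
  by (fastforce simp: near_def)

text \<open>
  Otherwise, let \<open>L i\<close> consist of the face \<open>x i = 0\<close> and the colour-\<open>i\<close> components close to it.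
  Kuhn's lemma applied to the labels "at distance at most 1 from \<open>L i\<close>" gives a small cube that is
  mixed for every \<open>i\<close>. If its corner has colour \<open>i\<close>, then it belongs to \<open>L i\<close>, so that the small
  cube is not mixed for \<open>i\<close>.
\<close>

lemma monochromatic_crossing:
  assumes "2 \<le> p" and col: "\<And>x. x \<in> cube n p \<Longrightarrow> col x < n"
  shows "\<exists>i<n. \<exists>x y. x \<in> cube n p \<and> col x = i \<and> x i \<le> 2 \<and> p \<le> y i + 1 \<and>
           (x, y) \<in> (col_step n p col i)\<^sup>*"
proof (rule ccontr)
  assume contra: "\<not> ?thesis"
  define L where "L i = {x \<in> cube n p. x i = 0} \<union>
      {y. \<exists>x \<in> cube n p. col x = i \<and> x i \<le> 2 \<and> (x, y) \<in> (col_step n p col i)\<^sup>*}" for i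
  have L_closed: "y \<in> L i"
    if "x \<in> L i" "y \<in> cube n p" "col y = i" "near n 2 x y" "i < n" for x y i
  proof (cases "x i = 0")
    case True
    \<comment> \<open>A face point may have any colour, so \<open>y\<close> starts a component of
      its own; hence starting points are allowed up to height 2.\<close>
    then have "y i \<le> 2" using that by (auto simp: near_def)
    then show ?thesis using that by (auto simp: L_def)
  next
    case False
    then obtain z where z: "z \<in> cube n p" "col z = i" "z i \<le> 2" "(z, x) \<in> (col_step n p col i)\<^sup>*"
      using \<open>x \<in> L i\<close> by (auto simp: L_def)
    then have "x \<in> cube n p" "col x = i"
      by (auto elim: rtranclE simp: col_step_def)
    then have "(x, y) \<in> col_step n p col i" using that by (simp add: col_step_def)
    then show ?thesis using z by (auto simp: L_def intro: rtrancl_into_rtrancl)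
  qed
  define label where "label x i = (if \<exists>w\<in>L i. near n 1 w x then 0 else 1 :: nat)" for x i
  have label_p: "label x i = 1" if "x i = p" "i < n" for x i
  proof (rule ccontr)
    assume "label x i \<noteq> 1"
    then obtain w where w: "w \<in> L i" "near n 1 w x"
      by (auto simp: label_def split: if_splits)
    then have "p \<le> w i + 1" using that by (auto simp: near_def)
    \<comment> \<open>Since \<open>2 \<le> p\<close>, the point \<open>w\<close> is off the face, so
      it ends a chain of the kind excluded by \<open>contra\<close>.\<close>
    then show False using w contra \<open>2 \<le> p\<close> that(2) by (auto simp: L_def)
  qed
  have label_0: "label x i = 0" if "x \<in> cube n p" "x i = 0" for x i
  proof -
    have "x \<in> L i" "near n 1 x x"
      using that by (simp_all add: L_def near_def)
    then show ?thesis by (auto simp: label_def)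
  qed
  obtain q where q: "\<forall>i<n. q i < p"
    and mixed: "\<forall>i<n. \<exists>r s. (\<forall>j<n. q j \<le> r j \<and> r j \<le> q j + 1) \<and>
        (\<forall>j<n. q j \<le> s j \<and> s j \<le> q j + 1) \<and> label r i \<noteq> label s i"
  proof (rule kuhn_lemma[of p n label])
    show "\<forall>x. (\<forall>i<n. x i \<le> p) \<longrightarrow> (\<forall>i<n. label x i = 0 \<or> label x i = 1)"
      by (simp add: label_def)
  qed (use \<open>2 \<le> p\<close> label_0 label_p in \<open>auto simp: cube_def\<close>)
  have "q \<in> cube n p" using q by (auto simp: cube_def less_imp_le)
  define i where "i = col q"
  have "i < n" using col \<open>q \<in> cube n p\<close> by (simp add: i_def)
  have same: "label s i = 0" if "near n 1 q r" "near n 1 q s" "label r i = 0" for r s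
  proof -
    obtain w where w: "w \<in> L i" "near n 1 w r"
      using \<open>label r i = 0\<close> by (auto simp: label_def split: if_splits)
    then have "near n 2 w q"
      using near_trans[of n 1 w r 1 q] \<open>near n 1 q r\<close> near_sym by (auto simp: numeral_2_eq_2)
    then have "q \<in> L i"
      using L_closed w \<open>q \<in> cube n p\<close> \<open>i < n\<close> by (auto simp: i_def)
    then show ?thesis using \<open>near n 1 q s\<close> by (auto simp: label_def)
  qed
  obtain r s where "\<forall>j<n. q j \<le> r j \<and> r j \<le> q j + 1" "\<forall>j<n. q j \<le> s j \<and> s j \<le> q j + 1"
    and "label r i \<noteq> label s i"
    using mixed \<open>i < n\<close> by blast
  then have "near n 1 q r" "near n 1 q s" "label r i \<noteq> label s i"
    by (auto simp: near_def le_SucI)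
  moreover have "label r i \<in> {0, 1}" "label s i \<in> {0, 1}"
    by (simp_all add: label_def)
  ultimately show False using same by (metis insertE singletonD)
qed

section \<open>Uniform subdivisions have layered treewidth at most one\<close>

text \<open>Triples are coded because the vertices of the graphs and the nodes of the trees are
  natural numbers.\<close>

definition enc :: "nat \<Rightarrow> nat \<Rightarrow> nat \<Rightarrow> nat" where
  "enc i j t = to_nat (i, j, t)"

lemma enc_inject [simp]: "enc i j t = enc i' j' t' \<longleftrightarrow> i = i' \<and> j = j' \<and> t = t'"
  by (simp add: enc_def)

definition dec :: "(nat \<Rightarrow> nat \<Rightarrow> nat \<Rightarrow> 'a) \<Rightarrow> nat \<Rightarrow> 'a" where
  "dec f x = (case from_nat x of (i, j, t) \<Rightarrow> f i j t)"

lemma dec_enc [simp]: "dec f (enc i j t) = f i j t"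
  by (simp add: dec_def enc_def)

text \<open>
  For an edge \<open>ij\<close> with \<open>i < j\<close>, the code \<open>enc i j t\<close> stands for the vertex at distance \<open>t\<close> from \<open>i\<close>
  on the path that replaces \<open>ij\<close>, and also for the node of the decomposition tree whose bag covers
  the edge from that vertex to the next. The codes \<open>enc i i 0\<close> are the branch vertices.
\<close>

locale subdivision =
  fixes K M :: nat and E :: "(nat \<times> nat) set"
  assumes E: "\<And>i j. (i, j) \<in> E \<Longrightarrow> i < j \<and> j < K"
    and K_pos: "0 < K" and even_M: "even M" and M_ge: "2 * K \<le> M"
begin

lemma M_pos: "0 < M"
  using K_pos M_ge by simp

lemma finite_E: "finite E"
  by (rule finite_subset[of _ "{..<K} \<times> {..<K}"]) (use E in \<open>fastforce+\<close>)

definition pt :: "nat \<Rightarrow> nat \<Rightarrow> nat \<Rightarrow> nat" where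
  "pt i j t = (if t = 0 then enc i i 0 else if t = M then enc j j 0 else enc i j t)"

abbreviation branch :: "nat \<Rightarrow> nat" where
  "branch i \<equiv> enc i i 0"

lemma pt_0 [simp]: "pt i j 0 = branch i" and pt_M [simp]: "pt i j M = branch j"
  using M_pos by (simp_all add: pt_def)

definition G :: "nat pair_pre_digraph" where
  "G = \<lparr>pverts = branch ` {..<K} \<union> {enc i j t | i j t. (i, j) \<in> E \<and> 0 < t \<and> t < M},
        parcs = (\<Union>(i, j)\<in>E. \<Union>t<M. {(pt i j t, pt i j (Suc t)), (pt i j (Suc t), pt i j t)})\<rparr>"

lemma branch_in_G: "i < K \<Longrightarrow> branch i \<in> pverts G"
  by (simp add: G_def)

lemma pt_in_G: "(i, j) \<in> E \<Longrightarrow> t \<le> M \<Longrightarrow> pt i j t \<in> pverts G"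
  using E[of i j] by (auto simp: G_def pt_def)

lemma arcs_G:
  assumes "(x, y) \<in> parcs G"
  obtains i j t where "(i, j) \<in> E" "t < M"
    "x = pt i j t \<and> y = pt i j (Suc t) \<or> x = pt i j (Suc t) \<and> y = pt i j t"
  using assms by (auto simp: G_def)

lemma arc_in_G:
  assumes "(i, j) \<in> E" "t < M"
  shows "(pt i j t, pt i j (Suc t)) \<in> parcs G" "(pt i j (Suc t), pt i j t) \<in> parcs G"
  using assms by (auto simp: G_def)

text \<open>
  The path that replaces an edge \<open>ij\<close> with \<open>i < j\<close> descends from layer \<open>2 i\<close> and then ascends to
  layer \<open>2 j\<close>, so that it meets layer \<open>2 j\<close> in its end only; consecutive vertices are in adjacent
  layers because \<open>M\<close> is even.
\<close>

definition layer :: "nat \<Rightarrow> int" where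
  "layer = dec (\<lambda>i j t. max (2 * int i - int t) (2 * int j - (int M - int t)))"

lemma layer_branch [simp]: "layer (branch i) = 2 * int i"
  by (simp add: layer_def)

text \<open>Only the two ends need an argument: there \<open>2 * K \<le> M\<close> makes the term
  belonging to the other end the smaller one.\<close>

lemma layer_pt:
  assumes "(i, j) \<in> E" "t \<le> M"
  shows "layer (pt i j t) = max (2 * int i - int t) (2 * int j - (int M - int t))"
  using assms E[of i j] M_ge by (auto simp: pt_def layer_def)

text \<open>For even \<open>M\<close> the falling and the rising term have the same parity, so they
  never differ by exactly 1, the only case in which their maximum would stay constant.\<close>

lemma layer_step:
  assumes "(i, j) \<in> E" "t < M"
  shows "\<bar>layer (pt i j (Suc t)) - layer (pt i j t)\<bar> = 1"
proof -
  obtain m where "M = 2 * m" using even_M by blast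
  then have "int M = 2 * int m" by simp
  moreover have "layer (pt i j t) = max (2 * int i - int t) (2 * int j - (int M - int t))"
    "layer (pt i j (Suc t)) = max (2 * int i - (int t + 1)) (2 * int j - (int M - (int t + 1)))"
    using assms by (simp_all add: layer_pt)
  moreover have "\<bar>max (2 * a - (u + 1)) (2 * b - (2 * c - (u + 1))) -
      max (2 * a - u) (2 * b - (2 * c - u))\<bar> = 1" for a b c u :: int
    by presburger
  ultimately show ?thesis by presburger
qed

lemma layer_less: "(i, j) \<in> E \<Longrightarrow> t < M \<Longrightarrow> layer (pt i j t) < 2 * int j"
  using E[of i j] by (simp add: layer_pt)

lemma pair_graph_G: "pair_graph G"
proof
  show "finite (pverts G)"
  proof -
    have "{enc i j t | i j t. (i, j) \<in> E \<and> 0 < t \<and> t < M} \<subseteq> (\<lambda>((i, j), t). enc i j t) ` (E \<times> {..<M})"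
      by force
    then have "finite {enc i j t | i j t. (i, j) \<in> E \<and> 0 < t \<and> t < M}"
      by (rule finite_subset) (simp add: finite_E)
    then show ?thesis by (simp add: G_def)
  qed
  show "finite (parcs G)"
    by (auto simp: G_def finite_E)
  show "symmetric (with_proj G)"
    by (auto simp: symmetric_def sym_def elim!: arcs_G intro: arc_in_G)
  show "fst e \<in> pverts G" "snd e \<in> pverts G" if "e \<in> parcs G" for e
    using that by (cases e; auto elim!: arcs_G intro: pt_in_G)+
  show "fst e \<noteq> snd e" if e: "e \<in> parcs G" for e
  proof -
    obtain x y where xy: "e = (x, y)" by fastforce
    with e obtain i j t where "(i, j) \<in> E" "t < M"
      "x = pt i j t \<and> y = pt i j (Suc t) \<or> x = pt i j (Suc t) \<and> y = pt i j t"
      by (auto elim: arcs_G)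
    then show ?thesis using layer_step[of i j t] xy by auto
  qed
qed

lemma layering_G: "layering G (\<lambda>k. {x \<in> pverts G. layer x = k})"
proof -
  have "\<exists>k. x \<in> pverts G \<and> y \<in> pverts G \<and> layer x \<in> {k, k + 1} \<and> layer y \<in> {k, k + 1}"
    if xy: "(x, y) \<in> parcs G" for x y
  proof -
    obtain i j t where ijt: "(i, j) \<in> E" "t < M"
      "x = pt i j t \<and> y = pt i j (Suc t) \<or> x = pt i j (Suc t) \<and> y = pt i j t"
      using xy by (rule arcs_G)
    then have "x \<in> pverts G" "y \<in> pverts G"
      by (auto intro: pt_in_G)
    moreover have "\<bar>layer x - layer y\<bar> = 1"
      using layer_step[of i j t] ijt by auto
    ultimately show ?thesis
      by (intro exI[of _ "min (layer x) (layer y)"]) auto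
  qed
  then show ?thesis
    unfolding layering_def disjoint_family_on_def by fastforce
qed

section \<open>The spider-shaped tree-decomposition\<close>

abbreviation "center \<equiv> enc 0 0 0"

text \<open>The center shares its code with branch vertex 0 but is a tree node here; no leg node has
  this code, since \<open>E\<close> joins distinct indices.\<close>

definition nodes :: "nat set" where
  "nodes = insert center {enc i j t | i j t. (i, j) \<in> E \<and> t < M}"

definition parent :: "nat \<Rightarrow> nat" where
  "parent = dec (\<lambda>i j t. if t = 0 then center else enc i j (t - 1))"

definition depth :: "nat \<Rightarrow> nat" where
  "depth x = (if x = center then 0 else dec (\<lambda>i j t. Suc t) x)"

text \<open>A leg sweeps from \<open>i\<close> towards \<open>j\<close>; keeping
  \<open>branch j\<close> in all its bags links the far end of the leg to the center.\<close>

definition bag :: "nat \<Rightarrow> nat set" where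
  "bag x = (if x = center then branch ` {..<K}
            else dec (\<lambda>i j t. {branch j, pt i j t, pt i j (Suc t)}) x)"

lemma not_center: "(i, j) \<in> E \<Longrightarrow> enc i j t \<noteq> center"
  using E[of i j] by auto

lemma bag_center [simp]: "bag center = branch ` {..<K}"
  by (simp add: bag_def)

lemma bag_enc: "(i, j) \<in> E \<Longrightarrow> bag (enc i j t) = {branch j, pt i j t, pt i j (Suc t)}"
  using E[of i j] by (auto simp: bag_def)

sublocale tr: rooted_tree nodes center parent depth
proof
  have "nodes = insert center ((\<lambda>((i, j), t). enc i j t) ` (E \<times> {..<M}))"
    by (force simp: nodes_def)
  then show "finite nodes" by (simp add: finite_E)
  show "center \<in> nodes" by (simp add: nodes_def)
  show "parent x \<in> nodes" if "x \<in> nodes" "x \<noteq> center" for x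
    using that by (auto simp: nodes_def parent_def)
  show "depth (parent x) < depth x" if "x \<in> nodes" "x \<noteq> center" for x
    using that by (auto simp: nodes_def parent_def depth_def split: if_splits)
qed

lemma tree_decomposition_G: "tree_decomposition G tr.T bag"
proof -
  have sub: "bag x \<subseteq> pverts G" if "x \<in> nodes" for x
  proof (cases "x = center")
    case False
    then obtain i j t where ijt: "(i, j) \<in> E" "t < M" "x = enc i j t"
      using \<open>x \<in> nodes\<close> by (auto simp: nodes_def)
    then show ?thesis
      using E[of i j] pt_in_G[of i j t] pt_in_G[of i j "Suc t"] branch_in_G[of j]
      by (simp add: bag_enc)
  qed (auto simp: branch_in_G)
  have arc: "\<exists>z\<in>nodes. x \<in> bag z \<and> y \<in> bag z" if xy: "(x, y) \<in> parcs G" for x y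
  proof -
    obtain i j t where ijt: "(i, j) \<in> E" "t < M"
      "x = pt i j t \<and> y = pt i j (Suc t) \<or> x = pt i j (Suc t) \<and> y = pt i j t"
      using xy by (rule arcs_G)
    then show ?thesis
      by (intro bexI[of _ "enc i j t"]) (auto simp: bag_enc nodes_def)
  qed
  \<comment> \<open>The witness \<open>z\<close> also yields that the bags cover all
    vertices.\<close>
  have conn: "\<exists>z\<in>nodes. v \<in> bag z \<and>
      Digraph_Component.connected (with_proj tr.T \<restriction> {x \<in> nodes. v \<in> bag x})"
    if v: "v \<in> pverts G" for v
  proof -
    from v consider (branch) k where "k < K" "v = branch k"
      | (inner) i j t where "(i, j) \<in> E" "0 < t" "t < M" "v = enc i j t"
      by (auto simp: G_def)
    then show ?thesis
    proof cases
      case branch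
      have "Digraph_Component.connected (with_proj tr.T \<restriction> {x \<in> nodes. v \<in> bag x})"
      proof (rule tr.connected_induced)
        show "center \<in> {x \<in> nodes. v \<in> bag x}" using branch by (auto simp: nodes_def)
        fix x assume x: "x \<in> {x \<in> nodes. v \<in> bag x}" "x \<noteq> center"
        then obtain i j t where ijt: "(i, j) \<in> E" "t < M" "x = enc i j t"
          by (auto simp: nodes_def)
        have "v \<in> bag (parent x)"
        proof (cases "t = 0")
          case True
          then show ?thesis using branch ijt by (auto simp: parent_def)
        next
          \<comment> \<open>Past the first node of a leg, \<open>branch i\<close> is gone, so
            \<open>v\<close> is \<open>branch j\<close>, which every bag of the leg
            contains.\<close>
          case False
          then have "branch k = branch j"
            using x ijt branch by (auto simp: bag_enc pt_def split: if_splits)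
          then show ?thesis using False branch ijt by (auto simp: parent_def bag_enc)
        qed
        then show "x \<noteq> center \<and> parent x \<in> {x \<in> nodes. v \<in> bag x}"
          using x tr.par_in by auto
      qed auto
      then show ?thesis using branch by (auto simp: nodes_def)
    next
      case inner
      have E': "i \<noteq> j" using inner E[of i j] by auto
      have bag_iff: "x \<in> nodes \<and> v \<in> bag x \<longleftrightarrow> x = enc i j t \<or> x = enc i j (t - 1)" for x
        using inner E' not_center[of i j] by (auto simp: nodes_def bag_enc pt_def split: if_splits)
      have "Digraph_Component.connected (with_proj tr.T \<restriction> {x \<in> nodes. v \<in> bag x})"
      proof (rule tr.connected_induced)
        show "enc i j (t - 1) \<in> {x \<in> nodes. v \<in> bag x}"
          by (simp add: bag_iff)
        fix x assume "x \<in> {x \<in> nodes. v \<in> bag x}" "x \<noteq> enc i j (t - 1)"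
        then have "x = enc i j t" by (simp add: bag_iff)
        moreover from this have "parent x = enc i j (t - 1)"
          using inner by (simp add: parent_def)
        ultimately show "x \<noteq> center \<and> parent x \<in> {x \<in> nodes. v \<in> bag x}"
          using inner(1) not_center bag_iff by auto
      qed auto
      then show ?thesis using bag_iff by blast
    qed
  qed
  show ?thesis
    unfolding tree_decomposition_def
    using tr.undirected_tree_T sub arc conn by fastforce
qed

text \<open>Layers separate the vertices of each bag: branch vertices have distinct layers,
  consecutive path vertices have adjacent layers, and \<open>branch j\<close> lies strictly above
  the rest of its path.\<close>

lemma layered_width_G: "layered_width_le tr.T bag (\<lambda>k. {x \<in> pverts G. layer x = k}) 1"
proof -
  have "inj_on layer (bag z)" if "z \<in> nodes" for z
  proof (cases "z = center")
    case False
    then obtain i j t where ijt: "(i, j) \<in> E" "t < M" "z = enc i j t"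
      using \<open>z \<in> nodes\<close> by (auto simp: nodes_def)
    have "inj_on layer {a, b, c}"
      if "layer b \<noteq> layer c" "layer b < layer a" "c = a \<or> layer c < layer a" for a b c
      using that by (auto simp: inj_on_def)
    moreover have "layer (pt i j t) \<noteq> layer (pt i j (Suc t))"
      using layer_step[OF ijt(1,2)] by auto
    moreover have "layer (pt i j t) < layer (branch j)"
      using layer_less ijt by auto
    moreover have "pt i j (Suc t) = branch j \<or> layer (pt i j (Suc t)) < layer (branch j)"
      using layer_less[of i j "Suc t"] ijt by (cases "Suc t = M") auto
    ultimately show ?thesis
      unfolding \<open>z = _\<close> bag_enc[OF ijt(1)] by blast
  qed (auto simp: inj_on_def)
  moreover have "finite (pverts G)"
    using pair_graph_G
    by (simp add: pair_graph_def pair_digraph_def pair_fin_digraph_def pair_fin_digraph_axioms_def)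
  ultimately have "card (bag z \<inter> {x \<in> pverts G. layer x = k}) \<le> Suc 0" if "z \<in> nodes" for z k
    using that by (subst card_le_Suc0_iff_eq) (auto dest: inj_onD)
  then show ?thesis by (auto simp: layered_width_le_def)
qed

lemma layered_treewidth_G: "layered_treewidth G \<le> 1"
  unfolding layered_treewidth_def
  by (rule Least_le) (use tree_decomposition_G layering_G layered_width_G in blast)

section \<open>Distances between branch vertices\<close>

lemma pair_wf_digraph_G: "pair_wf_digraph G"
  using pair_graph_G by (simp add: pair_graph_def pair_digraph_def pair_fin_digraph_def)

lemma graph_dist_branch_le:
  assumes "i < K" "j < K" "i = j \<or> (i, j) \<in> E \<or> (j, i) \<in> E"
  shows "graph_dist G (branch i) (branch j) \<le> ereal (real M)"
  using assms(3)
proof (elim disjE)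
  assume "i = j"
  then have "graph_dist G (branch i) (branch j) \<le> ereal (real 0)"
    using graph_dist_le_of_walk[OF pair_wf_digraph_G, of "\<lambda>_. branch i" 0] branch_in_G assms by simp
  then show ?thesis by (simp add: order_trans)
next
  assume "(i, j) \<in> E"
  then show ?thesis
    using graph_dist_le_of_walk[OF pair_wf_digraph_G, of "pt i j" M] branch_in_G assms
    by (simp add: arc_in_G)
next
  assume ji: "(j, i) \<in> E"
  have "(pt j i (M - t), pt j i (M - Suc t)) \<in> parcs G" if "t < M" for t
    using arc_in_G(2)[OF ji, of "M - Suc t"] that by (simp add: Suc_diff_Suc)
  then show ?thesis
    using graph_dist_le_of_walk[OF pair_wf_digraph_G, of "\<lambda>t. pt j i (M - t)" M] branch_in_G assms
    by simp
qed

text \<open>Interpolating \<open>M * a\<close> linearly along each path gives a function that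
  changes by \<open>\<bar>a i - a j\<bar> \<le> 1\<close> per arc.\<close>

lemma graph_dist_branch_ge:
  fixes a :: "nat \<Rightarrow> real"
  assumes a: "\<And>i j. (i, j) \<in> E \<Longrightarrow> \<bar>a i - a j\<bar> \<le> 1"
  shows "ereal (real M * \<bar>a i - a j\<bar>) \<le> graph_dist G (branch i) (branch j)"
proof -
  define f where "f = dec (\<lambda>i j t. (real M - real t) * a i + real t * a j)"
  have f_pt: "f (pt i j t) = (real M - real t) * a i + real t * a j" for i j t
    by (simp add: f_def pt_def)
  have "ereal \<bar>f (branch i) - f (branch j)\<bar> \<le> graph_dist G (branch i) (branch j)"
  proof (rule Lipschitz_le_graph_dist[OF pair_wf_digraph_G])
    fix x y assume "(x, y) \<in> parcs G"
    then obtain i j t where ijt: "(i, j) \<in> E"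
      "x = pt i j t \<and> y = pt i j (Suc t) \<or> x = pt i j (Suc t) \<and> y = pt i j t"
      by (rule arcs_G)
    have "f (pt i j t) - f (pt i j (Suc t)) = a i - a j"
      by (simp add: f_pt algebra_simps)
    then show "\<bar>f x - f y\<bar> \<le> 1"
      using ijt a[of i j] by auto
  qed
  moreover have "f (branch k) = real M * a k" for k
    by (simp add: f_def)
  ultimately show ?thesis
    by (simp add: right_diff_distrib[symmetric] abs_mult)
qed

end

section \<open>Contradiction from subdivided grids\<close>

theorem theorem1p13:
  shows "\<nexists>d :: int. asdim_linear_le
           (graph_mspace ` {G :: nat pair_pre_digraph. pair_graph G \<and> layered_treewidth G \<le> 1}) d"
proof
  assume "\<exists>d :: int. asdim_linear_le
           (graph_mspace ` {G :: nat pair_pre_digraph. pair_graph G \<and> layered_treewidth G \<le> 1}) d"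
  then obtain d :: int and D :: "real \<Rightarrow> real" and c :: real where
    control: "\<And>G :: nat pair_pre_digraph. pair_graph G \<Longrightarrow> layered_treewidth G \<le> 1 \<Longrightarrow>
        control_function d (graph_mspace G) D"
    and c: "c > 0" "\<And>r. r > 0 \<Longrightarrow> D r \<le> c * r + c"
    unfolding asdim_linear_le_def by auto
  define n where "n = nat (d + 1)"
  \<comment> \<open>The crossing has height at least \<open>p - 3\<close>, which must exceed
    \<open>4 * c\<close>. The choice depends on \<open>c\<close> only, so \<open>M\<close> can be
    chosen after \<open>p\<close>.\<close>
  define p where "p = nat \<lceil>4 * c\<rceil> + 4"
  have p: "real p > 4 * c + 3" "2 \<le> p"
    unfolding p_def by linarith+
  \<comment> \<open>A finite copy of the cube, made of extensional functions, so that its points can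
    be numbered by \<open>h\<close>.\<close>
  define Q where "Q = PiE {..<n} (\<lambda>_. {..p})"
  have finQ: "finite Q" by (simp add: Q_def finite_PiE)
  define K where "K = card Q"
  obtain h where h: "bij_betw h {0..<K} Q"
    using ex_bij_betw_nat_finite[OF finQ] unfolding K_def by blast
  have "Q \<noteq> {}" by (simp add: Q_def PiE_eq_empty_iff)
  then have "0 < K" using finQ by (simp add: K_def card_gt_0_iff)
  \<comment> \<open>Adjacency uses the radius 2 of \<open>col_step\<close>, so every colour step
    follows an edge or stays at one index.\<close>
  define E where "E = {(i, j). i < j \<and> j < K \<and> near n 2 (h i) (h j)}"
  define M where "M = 2 * K"
  interpret subdivision K M E
    by unfold_locales (use \<open>0 < K\<close> in \<open>auto simp: E_def M_def\<close>)
  define g where "g x = inv_into {0..<K} h (restrict x {..<n})" for x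
  have g: "g x < K" "\<And>i. i < n \<Longrightarrow> h (g x) i = x i" if "x \<in> cube n p" for x
  proof -
    have "restrict x {..<n} \<in> h ` {0..<K}"
      using that h by (auto simp: bij_betw_def Q_def cube_def)
    then show "g x < K" "\<And>i. i < n \<Longrightarrow> h (g x) i = x i"
      using inv_into_into[of "restrict x {..<n}" h "{0..<K}"]
      by (auto simp: g_def f_inv_into_f)
  qed
  have "real M > 0" using M_pos by simp
  moreover have "control_function d (pverts G, graph_dist G) D"
    using control[OF pair_graph_G layered_treewidth_G] by (simp add: graph_mspace_def)
  ultimately have "\<exists>\<U> :: int \<Rightarrow> nat set set.
      (\<forall>k\<in>{1..d+1}. \<U> k \<subseteq> Pow (pverts G) \<and> disjoint_by (graph_dist G) (real M) (\<U> k) \<and>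
        bounded_family (graph_dist G) (D (real M)) (\<U> k)) \<and>
      \<Union> (\<Union>k\<in>{1..d+1}. \<U> k) = pverts G"
    unfolding control_function_def prod.case by (elim conjE allE impE)
  then obtain \<U> :: "int \<Rightarrow> nat set set" where
    U: "\<forall>k\<in>{1..d+1}. \<U> k \<subseteq> Pow (pverts G) \<and> disjoint_by (graph_dist G) (real M) (\<U> k) \<and>
        bounded_family (graph_dist G) (D (real M)) (\<U> k)"
    and cover: "\<Union> (\<Union>k\<in>{1..d+1}. \<U> k) = pverts G"
    by (elim exE conjE)
  \<comment> \<open>Colours start at 0 and the families at 1, hence the shift.\<close>
  have "\<exists>i<n. \<exists>A\<in>\<U> (int i + 1). branch (g x) \<in> A" if "x \<in> cube n p" for x
  proof -
    have "branch (g x) \<in> pverts G" using g(1)[OF that] by (rule branch_in_G)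
    then obtain k A where "k \<in> {1..d+1}" "A \<in> \<U> k" "branch (g x) \<in> A"
      unfolding cover[symmetric] by blast
    then show ?thesis
      by (intro exI[of _ "nat (k - 1)"]) (auto simp: n_def)
  qed
  then obtain col where
    col: "\<And>x. x \<in> cube n p \<Longrightarrow> col x < n \<and> (\<exists>A\<in>\<U> (int (col x) + 1). branch (g x) \<in> A)"
    by metis
  obtain i x y where i: "i < n" and x: "x \<in> cube n p" "col x = i" "x i \<le> 2"
    and y: "p \<le> y i + 1" and xy: "(x, y) \<in> (col_step n p col i)\<^sup>*"
    using monochromatic_crossing[of p n col] p(2) col by blast
  have i': "int i + 1 \<in> {1..d+1}" using i by (auto simp: n_def)
  have "y \<in> cube n p"
    using xy x by (auto elim: rtranclE simp: col_step_def)
  \<comment> \<open>Consecutive points of the chain are at distance at most \<open>M\<close>, so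
    \<open>M\<close>-disjointness keeps the whole chain in one member.\<close>
  have "\<exists>A\<in>\<U> (int i + 1). branch (g x) \<in> A \<and> branch (g y) \<in> A"
    using xy
  proof (induction rule: rtrancl_induct)
    case base
    then show ?case using col x by auto
  next
    case (step y z)
    then have yz: "y \<in> cube n p" "z \<in> cube n p" "col z = i" "near n 2 y z"
      by (auto simp: col_step_def)
    obtain A where A: "A \<in> \<U> (int i + 1)" "branch (g x) \<in> A" "branch (g y) \<in> A"
      using step by auto
    obtain B where B: "B \<in> \<U> (int i + 1)" "branch (g z) \<in> B"
      using col yz by auto
    have "near n 2 (h (g y)) (h (g z))"
      using yz g by (simp add: near_def)
    then have "g y = g z \<or> (g y, g z) \<in> E \<or> (g z, g y) \<in> E"
      using g(1) yz near_sym by (auto simp: E_def)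
    then have "graph_dist G (branch (g y)) (branch (g z)) \<le> ereal (real M)"
      using graph_dist_branch_le g(1) yz by blast
    moreover have "ereal (real M) < graph_dist G (branch (g y)) (branch (g z))" if "A \<noteq> B"
      using bspec[OF U i'] A B that by (simp add: disjoint_by_def)
    ultimately have "A = B" by (meson leD)
    then show ?case using A B by auto
  qed
  then obtain A where A: "A \<in> \<U> (int i + 1)" "branch (g x) \<in> A" "branch (g y) \<in> A"
    by auto
  have "graph_dist G (branch (g x)) (branch (g y)) \<le> diam (graph_dist G) A"
    unfolding diam_def using A by (auto intro: SUP_upper2)
  also have "\<dots> \<le> ereal (D (real M))"
    using bspec[OF U i'] A by (auto simp: bounded_family_def)
  finally have up: "graph_dist G (branch (g x)) (branch (g y)) \<le> ereal (D (real M))" .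
  \<comment> \<open>Halved because the coordinates of adjacent points may differ by 2.\<close>
  define a where "a k = real (h k i) / 2" for k
  have "\<bar>a k - a l\<bar> \<le> 1" if "(k, l) \<in> E" for k l
  proof -
    have "h k i \<le> h l i + 2" "h l i \<le> h k i + 2"
      using that i by (auto simp: E_def near_def)
    then show ?thesis unfolding a_def by linarith
  qed
  then have "ereal (real M * \<bar>a (g x) - a (g y)\<bar>) \<le> ereal (D (real M))"
    using graph_dist_branch_ge[of a "g x" "g y"] up by (meson order_trans)
  also have "\<dots> \<le> ereal (c * real M + c)"
    using c(2) \<open>real M > 0\<close> by simp
  \<comment> \<open>Linear type enters here: as \<open>M \<ge> 1\<close>, the bound is a multiple of
    \<open>M\<close>, and cancelling \<open>M\<close> leaves \<open>2 * c\<close>, whatever the size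
    of the grid.\<close>
  also have "\<dots> \<le> ereal (real M * (2 * c))"
  proof -
    have "c * 1 \<le> c * real M"
      using c(1) M_pos by (intro mult_left_mono) auto
    then show ?thesis by simp
  qed
  finally have "\<bar>a (g x) - a (g y)\<bar> \<le> 2 * c"
    using \<open>real M > 0\<close> by simp
  moreover have "a (g x) = real (x i) / 2" "a (g y) = real (y i) / 2"
    using g(2) x(1) \<open>y \<in> cube n p\<close> i by (simp_all add: a_def)
  ultimately show False
    using x(3) y p(1) by linarith
qed

end
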